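(* Let $\theta\in\mathbb{R}$ with $|\theta|<\pi/2$ and let $\gamma>0$. If $f\in\mathcal{C}_\theta(\gamma)$, then the Schwarzian norm of $f$ satisfies $$\Vert S_f\Vert\le 2\gamma\cos\theta\,\sqrt{4+(\gamma^2+4\gamma)\cos^2\theta},$$ and the estimate is best possible, i.e. for each such $\theta$ and $\gamma$ the right-hand side cannot be replaced by a smaller constant valid for all $f\in\mathcal{C}_\theta(\gamma)$.
   Context: $\mathbb{D}=\{z\in\mathbb{C}:|z|<1\}$. $\mathcal{A}$ is the class of analytic functions $f$ in $\mathbb{D}$ with $f(0)=f'(0)-1=0$. For $|\theta|<\pi/2$ and $\gamma>0$, $\mathcal{C}_\theta(\gamma)$ is the class of all $f\in\mathcal{A}$ (with $f'$ non-vanishing in $\mathbb{D}$) such that $$\operatorname{Re}\left(e^{i\theta}\left(1+\frac{zf''(z)}{f'(z)}\right)\right)<\left(1+\frac{\gamma}{2}\right)\cos\theta\quad\text{for all } z\in\mathbb{D}.$$ For a locally univalent analytic function $f$ in $\mathbb{D}$, the Schwarzian derivative is $S_f=\left(\frac{f''}{f'}\right)'-\frac12\left(\frac{f''}{f'}\right)^2$ and the Schwarzian norm is $\Vert S_f\Vert=\sup_{z\in\mathbb{D}}(1-|z|^2)^2|S_f(z)|$. *)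

theory Defs
  imports "HOL-Complex_Analysis.Complex_Analysis" "HOL-Library.Extended_Real"
begin

definition class_A :: "(complex \<Rightarrow> complex) set" where
  "class_A = {f. f holomorphic_on ball 0 1 \<and> f 0 = 0 \<and> deriv f 0 - 1 = 0}"

definition class_C :: "real \<Rightarrow> real \<Rightarrow> (complex \<Rightarrow> complex) set" where
  "class_C \<theta> \<gamma> = {f \<in> class_A.
     (\<forall>z\<in>ball 0 1. deriv f z \<noteq> 0) \<and>
     (\<forall>z\<in>ball 0 1. Re (exp (\<i> * of_real \<theta>) * (1 + z * deriv (deriv f) z / deriv f z))
        < (1 + \<gamma> / 2) * cos \<theta>)}"

definition schwarzian :: "(complex \<Rightarrow> complex) \<Rightarrow> complex \<Rightarrow> complex" where
  "schwarzian f z =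
     deriv (\<lambda>w. deriv (deriv f) w / deriv f w) z - 1/2 * (deriv (deriv f) z / deriv f z)\<^sup>2"

text \<open>The supremum is taken in the extended reals, where it always exists and equals
  \<open>\<infinity>\<close> when the set is unbounded; a bound by a real number thus includes finiteness.\<close>

definition schwarzian_norm :: "(complex \<Rightarrow> complex) \<Rightarrow> ereal" where
  "schwarzian_norm f = (SUP z\<in>ball 0 1. ereal ((1 - (cmod z)\<^sup>2)\<^sup>2 * cmod (schwarzian f z)))"

end

theory Submission
  imports Defs
begin

text \<open>
  Put \<open>k = \<gamma> cos \<theta>\<close> and \<open>A = k e\<^sup>-\<^sup>i\<^sup>\<theta>\<close>. The half-plane condition says exactly that
  \<open>f''/f' = - A \<phi> / (1 - z \<phi>)\<close> with \<open>\<phi>\<close> holomorphic and \<open>|\<phi>| \<le> 1\<close>, which gives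
  \<open>S\<^sub>f = - A (\<phi>' + (1 + A/2) \<phi>\<^sup>2) / (1 - z \<phi>)\<^sup>2\<close>. The Schwarz--Pick inequality for \<open>\<phi>'\<close> and
  \<open>B = |1 + A/2| \<ge> 1\<close> then bound \<open>(1 - |z|\<^sup>2)\<^sup>2 |S\<^sub>f|\<close> by \<open>4 |A| B\<close>, the asserted constant.
  Sharpness comes from \<open>\<phi> = 1\<close>, that is \<open>f' = (1 - z)\<^sup>A\<close>, as \<open>z\<close> tends to \<open>1\<close> along the radius.
\<close>

section \<open>Schwarz-Pick inequality for the derivative\<close>

text \<open>Composing \<open>f\<close> with the disc automorphisms that send \<open>0\<close> to
  \<open>a\<close> and \<open>f a\<close> to \<open>0\<close> gives a self-map \<open>g\<close> of
  the disc fixing \<open>0\<close>. Schwarz's lemma bounds \<open>deriv g 0\<close>, and the chain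
  rule turns this into the claim.\<close>

lemma Schwarz_Pick_deriv_ball:
  fixes f :: "complex \<Rightarrow> complex"
  assumes hol: "f holomorphic_on ball 0 1"
    and bound: "\<And>z. norm z < 1 \<Longrightarrow> norm (f z) < 1"
    and a: "norm a < 1"
  shows "norm (deriv f a) * (1 - (norm a)\<^sup>2) \<le> 1 - (norm (f a))\<^sup>2"
proof -
  define b where "b = f a"
  define g where "g = (\<lambda>z. Moebius_function 0 b (f (Moebius_function 0 (-a) z)))"
  have b: "norm b < 1" using bound a by (simp add: b_def)
  have holM: "Moebius_function 0 (-a) holomorphic_on ball 0 1" "Moebius_function 0 b holomorphic_on ball 0 1"
    using a b by (auto intro!: Moebius_function_holomorphic)
  have Ma: "norm (Moebius_function 0 (-a) z) < 1" if "norm z < 1" for z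
    using Moebius_function_norm_lt_1[of "-a" z 0] a that by simp
  have holg: "g holomorphic_on ball 0 1"
  proof -
    have "(\<lambda>z. f (Moebius_function 0 (-a) z)) holomorphic_on ball 0 1"
      using Ma by (intro holomorphic_on_compose_gen[OF holM(1) hol, unfolded o_def]) auto
    then show ?thesis
      unfolding g_def using Ma bound
      by (intro holomorphic_on_compose_gen[OF _ holM(2), unfolded o_def]) auto
  qed
  have g0: "g 0 = 0" by (simp add: g_def Moebius_function_of_zero Moebius_function_eq_zero b_def)
  have g1: "norm (g z) < 1" if "norm z < 1" for z
    unfolding g_def using that Ma bound b by (auto intro!: Moebius_function_norm_lt_1)
  have sq: "1 - cnj w * w = of_real (1 - (norm w)\<^sup>2)" for w
    using complex_norm_square[of w] by (simp add: mult.commute)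
  have nz: "1 - (norm w)\<^sup>2 > 0" if "norm w < 1" for w :: complex
    using that by (simp add: power_less_one_iff abs_square_less_1)
  have nzc: "1 - cnj w * w \<noteq> 0" if "norm w < 1" for w
    unfolding sq using nz[OF that] by (metis less_irrefl of_real_eq_0_iff)
  \<comment> \<open>The next three facts are the chain-rule factors of \<open>deriv g 0\<close>: 1 -
    |a|^2 at \<open>0\<close>, \<open>deriv f a\<close> at \<open>a\<close>, and 1 / (1 - |b|^2) at
    \<open>b\<close>.\<close>
  have D1: "(Moebius_function 0 (-a) has_field_derivative (1 - cnj a * a)) (at 0)"
    unfolding Moebius_function_simple
    by (auto intro!: derivative_eq_intros simp: fun_eq_iff)
  have D2: "(f has_field_derivative deriv f a) (at (Moebius_function 0 (-a) 0))"
    using holomorphic_derivI[OF hol open_ball, of a] a by (simp add: Moebius_function_of_zero)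
  have D3: "(Moebius_function 0 b has_field_derivative 1 / (1 - cnj b * b))
      (at (f (Moebius_function 0 (-a) 0)))"
  proof -
    have "((\<lambda>z. z - b) has_field_derivative 1) (at b)"
      "((\<lambda>z. 1 - cnj b * z) has_field_derivative - cnj b) (at b)"
      by (auto intro!: derivative_eq_intros)
    from DERIV_divide[OF this nzc[OF b]]
    have "(Moebius_function 0 b has_field_derivative 1 / (1 - cnj b * b)) (at b)"
      using nzc[OF b] by (simp add: Moebius_function_simple[abs_def])
    then show ?thesis by (simp add: Moebius_function_of_zero b_def)
  qed
  have "(g has_field_derivative 1 / (1 - cnj b * b) * (deriv f a * (1 - cnj a * a))) (at 0)"
    unfolding g_def
    by (rule DERIV_chain2[where f = "Moebius_function 0 b", OF D3 DERIV_chain2[where f = f, OF D2 D1]])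
  then have dg: "deriv g 0 = 1 / (1 - cnj b * b) * (deriv f a * (1 - cnj a * a))"
    by (rule DERIV_imp_deriv)
  have "norm (deriv g 0) \<le> 1"
    by (rule Schwarz_Lemma(2)[OF holg g0 g1, of 0]) auto
  then show ?thesis
    using nz[OF b] nz[OF a] unfolding dg sq
    by (simp add: norm_mult norm_divide field_simps b_def del: of_real_diff)
qed

text \<open>Apply the strict version to \<open>t * f\<close> with 0 < t < 1 and let \<open>t\<close>
  tend to \<open>1\<close>. The non-strict bound admits unimodular constants, such as the multiplier
  \<open>1\<close> of the extremal function.\<close>

lemma Schwarz_Pick_deriv_cball:
  fixes f :: "complex \<Rightarrow> complex"
  assumes hol: "f holomorphic_on ball 0 1"
    and bound: "\<And>z. norm z < 1 \<Longrightarrow> norm (f z) \<le> 1"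
    and a: "norm a < 1"
  shows "norm (deriv f a) * (1 - (norm a)\<^sup>2) \<le> 1 - (norm (f a))\<^sup>2"
proof -
  have ev: "\<forall>\<^sub>F t in at_left (1::real). t * norm (deriv f a) * (1 - (norm a)\<^sup>2) \<le> 1 - (t * norm (f a))\<^sup>2"
    using eventually_at_left_real[of 0 "1::real", OF zero_less_one]
  proof eventually_elim
    case (elim t)
    have "norm (of_real t * f z) < 1" if "norm z < 1" for z
      using elim order.strict_trans1[OF mult_left_mono[OF bound[OF that], of t], of 1]
      by (simp add: norm_mult)
    moreover have "(\<lambda>z. of_real t * f z) holomorphic_on ball 0 1"
      using hol by (intro holomorphic_intros)
    moreover have "deriv (\<lambda>z. of_real t * f z) a = of_real t * deriv f a"
      using holomorphic_on_imp_differentiable_at[OF hol open_ball] a by (intro deriv_cmult) auto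
    ultimately show ?case
      using Schwarz_Pick_deriv_ball[of "\<lambda>z. of_real t * f z" a] a elim
      by (simp add: norm_mult)
  qed
  have "((\<lambda>t. t * norm (deriv f a) * (1 - (norm a)\<^sup>2)) \<longlongrightarrow> 1 * norm (deriv f a) * (1 - (norm a)\<^sup>2)) (at_left (1::real))"
    by (intro tendsto_intros)
  moreover have "((\<lambda>t. 1 - (t * norm (f a))\<^sup>2) \<longlongrightarrow> 1 - (1 * norm (f a))\<^sup>2) (at_left (1::real))"
    by (intro tendsto_intros)
  ultimately show ?thesis
    using tendsto_le[OF trivial_limit_at_left_real _ _ ev] by fastforce
qed

section \<open>Pointwise estimate of the weighted Schwarzian\<close>

text \<open>Here \<open>p\<close> and \<open>d\<close> stand for the values of \<phi> and its
  derivative at \<open>z\<close>. Everything reduces to the real inequality \<open>key\<close> in r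
  = |z| and s = |p|.\<close>

lemma weighted_schwarzian_bound:
  fixes A z p d :: complex
  assumes B: "1 \<le> cmod (1 + A/2)" and z: "cmod z < 1" and p: "cmod p \<le> 1"
    and d: "cmod d * (1 - (cmod z)\<^sup>2) \<le> 1 - (cmod p)\<^sup>2"
  shows "(1 - (cmod z)\<^sup>2)\<^sup>2 * cmod (- A * (d + (1 + A/2) * p\<^sup>2) / (1 - z * p)\<^sup>2)
    \<le> 4 * cmod A * cmod (1 + A/2)"
proof -
  define r where "r = cmod z"
  define s where "s = cmod p"
  define B where "B = cmod (1 + A/2)"
  have r: "0 \<le> r" "r < 1" and s: "0 \<le> s" "s \<le> 1" and B1: "1 \<le> B"
    using assms by (auto simp: r_def s_def B_def)
  have r2: "0 < 1 - r\<^sup>2" using r by (simp add: abs_square_less_1)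
  have rs1: "r * s \<le> r" using r s by (simp add: mult_left_le)
  have s2: "0 \<le> 1 - s\<^sup>2" using s by (simp add: power_le_one)
  have "1 - r * s \<le> cmod (1 - z * p)"
    using norm_triangle_ineq2[of 1 "z * p"] by (simp add: r_def s_def norm_mult)
  then have den: "(1 - r * s)\<^sup>2 \<le> (cmod (1 - z * p))\<^sup>2"
    using rs1 r by (intro power_mono) auto
  have den0: "0 < (1 - r * s)\<^sup>2" using rs1 r by simp
  \<comment> \<open>The left side of \<open>key\<close> factors as (1 - r^2) (1 - r s) (1 + r s).
    After removal of 1 - r s, the bounds 1 - r \<le> 1 - r s, 1 + r \<le> 2 and 1 + r s \<le> 2
    suffice.\<close>
  have "(1 - r) * (1 + r) * (1 + r * s) \<le> (1 - r * s) * 2 * 2"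
    using r s rs1 by (intro mult_mono) auto
  then have "(1 - r\<^sup>2) * (1 + r * s) \<le> 4 * (1 - r * s)"
    by (simp add: power2_eq_square algebra_simps)
  then have "(1 - r * s) * ((1 - r\<^sup>2) * (1 + r * s)) \<le> (1 - r * s) * (4 * (1 - r * s))"
    using rs1 r by (intro mult_left_mono) auto
  then have key: "(1 - r\<^sup>2) * (1 - s\<^sup>2) + s\<^sup>2 * (1 - r\<^sup>2)\<^sup>2 \<le> 4 * (1 - r * s)\<^sup>2"
    by (simp add: power2_eq_square algebra_simps)
  have "(1 - r\<^sup>2)\<^sup>2 * cmod (d + (1 + A/2) * p\<^sup>2) \<le> (1 - r\<^sup>2)\<^sup>2 * (cmod d + B * s\<^sup>2)"
    by (intro mult_left_mono order_trans[OF norm_triangle_ineq])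
       (auto simp: norm_mult norm_power B_def s_def)
  also have "\<dots> = (1 - r\<^sup>2) * (cmod d * (1 - r\<^sup>2)) + B * (s\<^sup>2 * (1 - r\<^sup>2)\<^sup>2)"
    by (simp add: power2_eq_square algebra_simps)
  also have "\<dots> \<le> (1 - r\<^sup>2) * (1 - s\<^sup>2) + B * (s\<^sup>2 * (1 - r\<^sup>2)\<^sup>2)"
    using d r2 by (intro add_mono mult_left_mono) (auto simp: r_def s_def B_def)
  \<comment> \<open>Since \<open>1 \<le> B\<close>, the Schwarz-Pick term may also carry the factor
    \<open>B\<close>; the sum is then \<open>B\<close> times the left side of
    \<open>key\<close>.\<close>
  also have "\<dots> \<le> B * ((1 - r\<^sup>2) * (1 - s\<^sup>2)) + B * (s\<^sup>2 * (1 - r\<^sup>2)\<^sup>2)"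
    using mult_right_mono[OF B1, of "(1 - r\<^sup>2) * (1 - s\<^sup>2)"] r2 s2 by simp
  also have "\<dots> \<le> B * (4 * (1 - r * s)\<^sup>2)"
    using key B1 unfolding distrib_left[symmetric] by (intro mult_left_mono) auto
  also have "\<dots> \<le> B * (4 * (cmod (1 - z * p))\<^sup>2)"
    using den B1 by (intro mult_left_mono) auto
  finally have "cmod A * ((1 - r\<^sup>2)\<^sup>2 * cmod (d + (1 + A/2) * p\<^sup>2))
      \<le> cmod A * (B * (4 * (cmod (1 - z * p))\<^sup>2))"
    by (intro mult_left_mono) auto
  then have "(1 - r\<^sup>2)\<^sup>2 * (cmod A * cmod (d + (1 + A/2) * p\<^sup>2)) / (cmod (1 - z * p))\<^sup>2 \<le> 4 * cmod A * B"
    using den den0 by (subst pos_divide_le_eq) (auto simp: mult_ac)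
  then show ?thesis
    by (simp add: norm_mult norm_divide norm_power r_def B_def)
qed

section \<open>The Schwarzian in terms of the multiplier\<close>

lemma has_field_derivative_pre_schwarzian:
  fixes \<phi> :: "complex \<Rightarrow> complex"
  assumes "(\<phi> has_field_derivative d) (at z)" and "1 - z * \<phi> z \<noteq> 0"
  shows "((\<lambda>w. - A * \<phi> w / (1 - w * \<phi> w)) has_field_derivative
    - A * (d + (\<phi> z)\<^sup>2) / (1 - z * \<phi> z)\<^sup>2) (at z)"
proof -
  have "((\<lambda>w. - A * \<phi> w) has_field_derivative - A * d) (at z)"
    "((\<lambda>w. 1 - w * \<phi> w) has_field_derivative - (\<phi> z + z * d)) (at z)"
    using assms(1) by (auto intro!: derivative_eq_intros)
  from DERIV_divide[OF this assms(2)]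
  have "((\<lambda>w. - A * \<phi> w / (1 - w * \<phi> w)) has_field_derivative
      (- A * d * (1 - z * \<phi> z) - - A * \<phi> z * - (\<phi> z + z * d)) / (1 - z * \<phi> z)\<^sup>2) (at z)"
    by (simp only: power2_eq_square)
  \<comment> \<open>The two terms with \<open>z * \<phi> z * d\<close> cancel.\<close>
  also have "- A * d * (1 - z * \<phi> z) - - A * \<phi> z * - (\<phi> z + z * d) = - A * (d + (\<phi> z)\<^sup>2)"
    by (simp add: power2_eq_square algebra_simps)
  finally show ?thesis .
qed

lemma schwarzian_eq_of_pre_schwarzian:
  assumes "open S" "z \<in> S"
    and T: "\<And>w. w \<in> S \<Longrightarrow> deriv (deriv f) w / deriv f w = - A * \<phi> w / (1 - w * \<phi> w)"
    and d: "(\<phi> has_field_derivative d) (at z)" and nz: "1 - z * \<phi> z \<noteq> 0"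
  shows "schwarzian f z = - A * (d + (1 + A/2) * (\<phi> z)\<^sup>2) / (1 - z * \<phi> z)\<^sup>2"
proof -
  have ev: "\<forall>\<^sub>F w in nhds z. deriv (deriv f) w / deriv f w = - A * \<phi> w / (1 - w * \<phi> w)"
    using eventually_nhds_in_open[OF assms(1,2)] by eventually_elim (rule T)
  have "deriv (\<lambda>w. deriv (deriv f) w / deriv f w) z = - A * (d + (\<phi> z)\<^sup>2) / (1 - z * \<phi> z)\<^sup>2"
    using deriv_cong_ev[OF ev refl] DERIV_imp_deriv[OF has_field_derivative_pre_schwarzian[OF d nz]]
    by simp
  \<comment> \<open>The square of the pre-Schwarzian has the same denominator and contributes - A^2
    \<phi>^2 / 2, which raises the coefficient of \<phi>^2 from 1 to 1 + A/2.\<close>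
  moreover have num: "- A * (d + (1 + A/2) * (\<phi> z)\<^sup>2) = - A * (d + (\<phi> z)\<^sup>2) - 1/2 * (- A * \<phi> z)\<^sup>2"
    by (simp add: power2_eq_square algebra_simps)
  ultimately show ?thesis
    unfolding schwarzian_def T[OF assms(2)] power_divide
    by (simp only: num times_divide_eq_right flip: diff_divide_distrib)
qed

section \<open>From the half-plane condition to a bounded multiplier\<close>

text \<open>The map u \<mapsto> u / (u - k) takes the half-plane Re u < k/2 into the unit disc and
  fixes \<open>0\<close>. Applied to u = e z T(z) it gives a Schwarz function \<omega>, and \<phi>
  is \<omega>(z) / z.\<close>

lemma half_plane_multiplier:
  fixes T :: "complex \<Rightarrow> complex" and k :: real
  assumes k: "0 < k" and e: "cmod e = 1" and hol: "T holomorphic_on ball 0 1"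
    and half: "\<And>z. cmod z < 1 \<Longrightarrow> Re (e * (z * T z)) < k / 2"
  obtains \<phi> where "\<phi> holomorphic_on ball 0 1" "\<And>z. cmod z < 1 \<Longrightarrow> cmod (\<phi> z) \<le> 1"
    "\<And>z. cmod z < 1 \<Longrightarrow> 1 - z * \<phi> z \<noteq> 0"
    "\<And>z. cmod z < 1 \<Longrightarrow> T z = - (of_real k / e) * \<phi> z / (1 - z * \<phi> z)"
proof -
  define u where "u = (\<lambda>z. e * (z * T z))"
  \<comment> \<open>The factor \<open>z\<close> of \<omega> is cancelled in advance, so that \<phi>
    is visibly holomorphic at \<open>0\<close> with no removable singularity to treat.\<close>
  define \<phi> where "\<phi> = (\<lambda>z. e * T z / (u z - of_real k))"
  have uk: "u z - of_real k \<noteq> 0" if "cmod z < 1" for z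
    using half[OF that] k by (auto simp: u_def complex_eq_iff)
  have hol\<phi>: "\<phi> holomorphic_on ball 0 1"
    unfolding \<phi>_def using uk by (auto simp: u_def intro!: holomorphic_intros hol)
  define \<omega> where "\<omega> = (\<lambda>z. z * \<phi> z)"
  have hol\<omega>: "\<omega> holomorphic_on ball 0 1" unfolding \<omega>_def by (intro holomorphic_intros hol\<phi>)
  have \<omega>1: "cmod (\<omega> z) < 1" if "cmod z < 1" for z
  proof -
    have "(cmod (u z))\<^sup>2 < (cmod (u z - of_real k))\<^sup>2"
    proof -
      \<comment> \<open>Re u < k/2 says that u is closer to \<open>0\<close> than to
        \<open>k\<close>.\<close>
      have "(cmod (u z - of_real k))\<^sup>2 = (cmod (u z))\<^sup>2 + 2 * k * (k / 2 - Re (u z))"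
        by (simp add: cmod_power2) (simp add: power2_eq_square algebra_simps)
      moreover have "0 < 2 * k * (k / 2 - Re (u z))"
        using half[OF that] k by (intro mult_pos_pos) (auto simp: u_def)
      ultimately show ?thesis by simp
    qed
    then have "cmod (u z) < cmod (u z - of_real k)" by (rule power2_less_imp_less) simp
    moreover have "\<omega> z = u z / (u z - of_real k)" by (simp add: \<omega>_def \<phi>_def u_def)
    moreover have "0 < cmod (u z - of_real k)" using uk[OF that] by simp
    ultimately show ?thesis by (simp add: norm_divide)
  qed
  have \<omega>0: "\<omega> 0 = 0" by (simp add: \<omega>_def)
  have d\<omega>: "deriv \<omega> 0 = \<phi> 0"
  proof (rule DERIV_imp_deriv)
    have "(\<phi> has_field_derivative deriv \<phi> 0) (at 0)"
      by (rule holomorphic_derivI[OF hol\<phi>]) auto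
    then show "(\<omega> has_field_derivative \<phi> 0) (at 0)"
      unfolding \<omega>_def by (auto intro!: derivative_eq_intros)
  qed
  show ?thesis
  proof
    show "\<phi> holomorphic_on ball 0 1" by fact
    fix z :: complex assume z: "cmod z < 1"
    show "cmod (\<phi> z) \<le> 1"
    \<comment> \<open>At \<open>0\<close> the bound is the derivative half of Schwarz's lemma,
      because \<phi> and the derivative of \<omega> agree there; elsewhere |\<omega>(z)| \<le> |z|
      is divided by |z|.\<close>
    proof (cases "z = 0")
      case True
      then show ?thesis using Schwarz_Lemma(2)[OF hol\<omega> \<omega>0 \<omega>1 z] d\<omega> by simp
    next
      case False
      then show ?thesis using Schwarz_Lemma(1)[OF hol\<omega> \<omega>0 \<omega>1 z] by (simp add: \<omega>_def norm_mult)
    qed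
    show nz: "1 - z * \<phi> z \<noteq> 0" using \<omega>1[OF z] by (auto simp: \<omega>_def)
    have e0: "e \<noteq> 0" using e by auto
    have k0: "complex_of_real k \<noteq> 0" using k by simp
    \<comment> \<open>This inverts the map: dividing \<phi> by 1 - z \<phi> cancels u - k and leaves
      - e T / k.\<close>
    have "1 - z * \<phi> z = - of_real k / (u z - of_real k)"
      using uk[OF z] by (simp add: \<phi>_def u_def field_simps)
    then show "T z = - (of_real k / e) * \<phi> z / (1 - z * \<phi> z)"
      using uk[OF z] e0 k0 by (simp add: \<phi>_def)
  qed
qed

section \<open>The upper bound on the class\<close>

lemma class_C_half_plane_iff:
  "Re (exp (\<i> * of_real \<theta>) * (1 + w)) < (1 + \<gamma> / 2) * cos \<theta> \<longleftrightarrow>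
   Re (exp (\<i> * of_real \<theta>) * w) < \<gamma> * cos \<theta> / 2"
  by (simp add: distrib_left distrib_right flip: cis_conv_exp)

text \<open>For k = \<gamma> cos \<theta> the right side is a quarter of the radicand in the
  asserted constant. It also shows that |1 + A/2| is at least 1 when k and cos \<theta> are
  nonnegative.\<close>

lemma norm_one_plus_half_rotated:
  "(cmod (1 + of_real k / exp (\<i> * of_real \<theta>) / 2))\<^sup>2 = 1 + k * cos \<theta> + k\<^sup>2 / 4"
proof -
  have "of_real k / exp (\<i> * of_real \<theta>) = of_real k * cis (- \<theta>)"
    by (simp only: divide_inverse cis_inverse flip: cis_conv_exp)
  then have "(cmod (1 + of_real k / exp (\<i> * of_real \<theta>) / 2))\<^sup>2
      = (1 + k / 2 * cos \<theta>)\<^sup>2 + (k / 2 * sin \<theta>)\<^sup>2"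
    by (simp add: cmod_power2 mult.commute)
  also have "\<dots> = 1 + k * cos \<theta> + k\<^sup>2 / 4 * ((sin \<theta>)\<^sup>2 + (cos \<theta>)\<^sup>2)"
    by (simp only: power2_eq_square) (simp add: field_simps del: sin_cos_squared_add3)
  finally show ?thesis by simp
qed

text \<open>The multiplier of \<open>f\<close> brings the Schwarzian into the form treated by
  \<open>weighted_schwarzian_bound\<close>, with \<open>d = deriv \<phi> z\<close>; Schwarz-Pick
  supplies the hypothesis on \<open>d\<close>.\<close>

lemma class_C_schwarzian_norm_le:
  assumes k: "0 < \<gamma> * cos \<theta>" "0 \<le> cos \<theta>" and f: "f \<in> class_C \<theta> \<gamma>"
  defines "A \<equiv> of_real (\<gamma> * cos \<theta>) / exp (\<i> * of_real \<theta>)"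
  shows "schwarzian_norm f \<le> ereal (4 * cmod A * cmod (1 + A/2))"
proof -
  let ?T = "\<lambda>z. deriv (deriv f) z / deriv f z"
  have hol: "f holomorphic_on ball 0 1" and nz: "\<And>z. cmod z < 1 \<Longrightarrow> deriv f z \<noteq> 0"
    using f by (auto simp: class_C_def class_A_def)
  have holT: "?T holomorphic_on ball 0 1"
    using nz by (intro holomorphic_intros holomorphic_deriv hol) auto
  have "Re (exp (\<i> * of_real \<theta>) * (z * ?T z)) < \<gamma> * cos \<theta> / 2" if "cmod z < 1" for z
    using f that unfolding class_C_def class_C_half_plane_iff by auto
  from half_plane_multiplier[OF k(1) _ holT this]
  obtain \<phi> where \<phi>: "\<phi> holomorphic_on ball 0 1" "\<And>z. cmod z < 1 \<Longrightarrow> cmod (\<phi> z) \<le> 1"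
    "\<And>z. cmod z < 1 \<Longrightarrow> 1 - z * \<phi> z \<noteq> 0"
    "\<And>z. cmod z < 1 \<Longrightarrow> ?T z = - A * \<phi> z / (1 - z * \<phi> z)"
    unfolding A_def by (metis norm_exp_i_times)
  have "1 \<le> (cmod (1 + A/2))\<^sup>2"
    unfolding A_def norm_one_plus_half_rotated using k by simp
  then have B: "1 \<le> cmod (1 + A/2)"
    using power2_le_imp_le[of 1 "cmod (1 + A/2)"] by simp
  have "(1 - (cmod z)\<^sup>2)\<^sup>2 * cmod (schwarzian f z) \<le> 4 * cmod A * cmod (1 + A/2)"
    if z: "cmod z < 1" for z
  proof -
    have "(\<phi> has_field_derivative deriv \<phi> z) (at z)"
      using z by (intro holomorphic_derivI[OF \<phi>(1)]) auto
    then have "schwarzian f z = - A * (deriv \<phi> z + (1 + A/2) * (\<phi> z)\<^sup>2) / (1 - z * \<phi> z)\<^sup>2"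
      using z \<phi>(3,4) by (intro schwarzian_eq_of_pre_schwarzian[of "ball 0 1"]) auto
    then show ?thesis
      using weighted_schwarzian_bound[OF B z \<phi>(2)[OF z]] Schwarz_Pick_deriv_cball[OF \<phi>(1,2) z]
      by simp
  qed
  then show ?thesis
    unfolding schwarzian_norm_def by (intro SUP_least) simp
qed

section \<open>The extremal function and sharpness\<close>

text \<open>Re (z / (1 - z)) + 1/2 equals (1 - |z|^2) / (2 |1 - z|^2), which is positive. This is
  the half-plane condition for the multiplier \<open>1\<close>.\<close>

lemma Re_div_one_minus_gt:
  assumes "cmod z < 1"
  shows "Re (z / (1 - z)) > - 1/2"
proof -
  have nz: "1 - z \<noteq> 0" using assms by auto
  have "0 < (1 - (cmod z)\<^sup>2) / (cmod (1 - z))\<^sup>2"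
    using assms nz by (intro divide_pos_pos) (auto simp: abs_square_less_1)
  moreover have "Re (z / (1 - z)) + 1/2 = (1 - (cmod z)\<^sup>2) / (cmod (1 - z))\<^sup>2 / 2"
  proof -
    have "z / (1 - z) = z * cnj (1 - z) / of_real ((cmod (1 - z))\<^sup>2)"
      by (simp add: complex_div_cnj[of z])
    then have "Re (z / (1 - z)) = Re (z * cnj (1 - z)) / (cmod (1 - z))\<^sup>2"
      by (metis Re_divide_of_real)
    \<comment> \<open>Polarization: \<open>z\<close> and \<open>1 - z\<close> have sum 1, so 1 =
      |z|^2 + |1 - z|^2 + 2 Re (z cnj (1 - z)).\<close>
    moreover have "Re (z * cnj (1 - z)) = ((1 - (cmod z)\<^sup>2) - (cmod (1 - z))\<^sup>2) / 2"
      by (simp add: cmod_power2) (simp add: power2_eq_square algebra_simps)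
    ultimately show ?thesis using nz by (simp add: field_simps)
  qed
  ultimately have "0 < Re (z / (1 - z)) + 1/2" by simp
  then show ?thesis by linarith
qed

text \<open>The primitive of (1 - z)^A that vanishes at \<open>0\<close>, with the principal branch
  of the power. At A = -1 the division by zero makes it the zero function, whence the hypothesis
  \<open>A + 1 \<noteq> 0\<close> below.\<close>

definition extremal :: "complex \<Rightarrow> complex \<Rightarrow> complex" where
  "extremal A z = (1 - (1 - z) powr (A + 1)) / (A + 1)"

lemma
  assumes z: "cmod z < 1" and A: "A + 1 \<noteq> 0"
  shows DERIV_extremal: "(extremal A has_field_derivative (1 - z) powr A) (at z)"
    and deriv2_extremal: "deriv (deriv (extremal A)) z = - A * (1 - z) powr A / (1 - z)"
proof -
  have D: "((\<lambda>z. (1 - z) powr s) has_field_derivative - s * (1 - z) powr (s - 1)) (at z)"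
    if "cmod z < 1" for s z
  proof -
    \<comment> \<open>On the disc \<open>1 - z\<close> lies in the right half-plane, away from the
      branch cut.\<close>
    have "Re z < 1" using that complex_Re_le_cmod[of z] by linarith
    then have "1 - z \<notin> \<real>\<^sub>\<le>\<^sub>0" by (auto simp: complex_nonpos_Reals_iff)
    then show ?thesis by (auto intro!: derivative_eq_intros)
  qed
  have E: "(extremal A has_field_derivative (1 - z) powr A) (at z)" if "cmod z < 1" for z
  proof -
    have "((\<lambda>z. (1 - (1 - z) powr (A + 1)) / (A + 1)) has_field_derivative
        (0 - (- (A + 1) * (1 - z) powr (A + 1 - 1))) / (A + 1)) (at z)"
      by (intro DERIV_cdivide DERIV_diff D that DERIV_const)
    moreover have "(0 - (- (A + 1) * (1 - z) powr (A + 1 - 1))) / (A + 1) = (1 - z) powr A"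
      using A by (simp add: divide_eq_eq algebra_simps)
    ultimately show ?thesis unfolding extremal_def[abs_def] by simp
  qed
  show "(extremal A has_field_derivative (1 - z) powr A) (at z)" by (rule E[OF z])
  have "\<forall>\<^sub>F w in nhds z. w \<in> ball 0 1" using z by (intro eventually_nhds_in_open) auto
  then have "\<forall>\<^sub>F w in nhds z. deriv (extremal A) w = (1 - w) powr A"
    by eventually_elim (auto intro!: DERIV_imp_deriv E)
  then have "deriv (deriv (extremal A)) z = deriv (\<lambda>w. (1 - w) powr A) z"
    by (rule deriv_cong_ev) simp
  also have "\<dots> = - A * (1 - z) powr (A - 1)" by (rule DERIV_imp_deriv[OF D[OF z]])
  also have "\<dots> = - A * (1 - z) powr A / (1 - z)"
    using z by (auto simp: powr_diff)
  finally show "deriv (deriv (extremal A)) z = - A * (1 - z) powr A / (1 - z)" .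
qed

lemma pre_schwarzian_extremal:
  assumes z: "cmod z < 1" and A: "A + 1 \<noteq> 0"
  shows "deriv (extremal A) z \<noteq> 0"
    and "deriv (deriv (extremal A)) z / deriv (extremal A) z = - A / (1 - z)"
proof -
  have "1 - z \<noteq> 0" using z by auto
  then show "deriv (extremal A) z \<noteq> 0"
    and "deriv (deriv (extremal A)) z / deriv (extremal A) z = - A / (1 - z)"
    using DERIV_imp_deriv[OF DERIV_extremal[OF assms]] deriv2_extremal[OF assms] by auto
qed

lemma extremal_in_class_C:
  assumes k: "0 < \<gamma> * cos \<theta>" "0 \<le> cos \<theta>"
  defines "A \<equiv> of_real (\<gamma> * cos \<theta>) / exp (\<i> * of_real \<theta>)"
  shows "A + 1 \<noteq> 0" and "extremal A \<in> class_C \<theta> \<gamma>"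
proof -
  have "A = cis (- \<theta>) * of_real (\<gamma> * cos \<theta>)"
    by (simp add: A_def cis_inverse divide_inverse mult.commute flip: cis_conv_exp)
  \<comment> \<open>A nonnegative real part keeps \<open>A\<close> away from -1.\<close>
  then have "Re A = \<gamma> * cos \<theta> * cos \<theta>" by simp
  then have "Re A \<ge> 0" using k by simp
  then show A: "A + 1 \<noteq> 0" by (auto simp: complex_eq_iff)
  have "extremal A holomorphic_on ball 0 1"
    using DERIV_extremal[OF _ A] by (metis holomorphic_on_open open_ball mem_ball_0)
  moreover have "extremal A 0 = 0" "deriv (extremal A) 0 = 1"
    using DERIV_imp_deriv[OF DERIV_extremal[OF _ A, of 0]] by (auto simp: extremal_def)
  moreover have "Re (exp (\<i> * of_real \<theta>) *
      (1 + z * deriv (deriv (extremal A)) z / deriv (extremal A) z)) < (1 + \<gamma> / 2) * cos \<theta>"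
    if z: "cmod z < 1" for z
  proof -
    have "exp (\<i> * of_real \<theta>) * (z * deriv (deriv (extremal A)) z / deriv (extremal A) z)
        = exp (\<i> * of_real \<theta>) * (z * (- A / (1 - z)))"
      using pre_schwarzian_extremal(2)[OF z A] by (metis times_divide_eq_right)
    \<comment> \<open>The rotation in \<open>A\<close> cancels the factor
      \<open>exp (\<i> * of_real \<theta>)\<close>, leaving a negative real multiple of z / (1 -
      z).\<close>
    also have "\<dots> = - (of_real (\<gamma> * cos \<theta>) * (z / (1 - z)))"
      by (simp add: A_def)
    finally have "Re (exp (\<i> * of_real \<theta>) * (z * deriv (deriv (extremal A)) z / deriv (extremal A) z))
        = - (\<gamma> * cos \<theta> * Re (z / (1 - z)))"
      by (simp only: uminus_complex.sel times_complex.sel Re_complex_of_real Im_complex_of_real mult_zero_left diff_zero)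
    also have "\<dots> < \<gamma> * cos \<theta> / 2"
      using mult_strict_left_mono[OF Re_div_one_minus_gt[OF z] k(1)] by linarith
    finally show ?thesis unfolding class_C_half_plane_iff .
  qed
  ultimately show "extremal A \<in> class_C \<theta> \<gamma>"
    using pre_schwarzian_extremal(1)[OF _ A] by (auto simp: class_C_def class_A_def)
qed

text \<open>On the positive radius the weighted Schwarzian equals |A| |1 + A/2| (1 + r)^2; the
  constant is its limit as r tends to 1.\<close>

lemma schwarzian_norm_extremal_ge:
  assumes A: "A + 1 \<noteq> 0" and M: "schwarzian_norm (extremal A) \<le> ereal M"
  shows "4 * cmod A * cmod (1 + A/2) \<le> M"
proof -
  have le: "cmod A * cmod (1 + A/2) * (1 + r)\<^sup>2 \<le> M" if r: "0 < r" "r < 1" for r :: real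
  proof -
    let ?z = "complex_of_real r"
    have z: "cmod ?z < 1" using r by simp
    \<comment> \<open>The multiplier is the constant \<open>1\<close>, so
      \<open>d = 0\<close>.\<close>
    have "schwarzian (extremal A) ?z = - A * (0 + (1 + A/2) * 1\<^sup>2) / (1 - ?z * 1)\<^sup>2"
      using r pre_schwarzian_extremal(2)[OF _ A]
      by (intro schwarzian_eq_of_pre_schwarzian[of "ball 0 1"]) auto
    then have "cmod (schwarzian (extremal A) ?z) = cmod A * cmod (1 + A/2) / (cmod (of_real (1 - r)))\<^sup>2"
      by (simp add: norm_mult norm_divide norm_power)
    also have "\<dots> = cmod A * cmod (1 + A/2) / (1 - r)\<^sup>2" by (simp add: norm_of_real del: of_real_diff)
    finally have "(1 - (cmod ?z)\<^sup>2)\<^sup>2 * cmod (schwarzian (extremal A) ?z)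
        = (1 - r\<^sup>2)\<^sup>2 / (1 - r)\<^sup>2 * (cmod A * cmod (1 + A/2))"
      by simp
    \<comment> \<open>The weight cancels the double pole of the Schwarzian at \<open>1\<close>
      exactly.\<close>
    also have "(1 - r\<^sup>2)\<^sup>2 = (1 - r)\<^sup>2 * (1 + r)\<^sup>2"
      by (simp add: power2_eq_square algebra_simps)
    finally have "(1 - (cmod ?z)\<^sup>2)\<^sup>2 * cmod (schwarzian (extremal A) ?z)
        = cmod A * cmod (1 + A/2) * (1 + r)\<^sup>2"
      using r by simp
    moreover have "ereal ((1 - (cmod ?z)\<^sup>2)\<^sup>2 * cmod (schwarzian (extremal A) ?z)) \<le> ereal M"
      using z by (intro order_trans[OF SUP_upper M[unfolded schwarzian_norm_def]]) auto
    ultimately show ?thesis by simp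
  qed
  have "((\<lambda>r. cmod A * cmod (1 + A/2) * (1 + r)\<^sup>2) \<longlongrightarrow> cmod A * cmod (1 + A/2) * (1 + 1)\<^sup>2)
      (at_left (1::real))"
    by (intro tendsto_intros)
  moreover have "\<forall>\<^sub>F r in at_left (1::real). cmod A * cmod (1 + A/2) * (1 + r)\<^sup>2 \<le> M"
    using eventually_at_left_real[of 0 "1::real", OF zero_less_one]
    by eventually_elim (auto intro: le)
  ultimately have "cmod A * cmod (1 + A/2) * (1 + 1)\<^sup>2 \<le> M"
    using tendsto_upperbound trivial_limit_at_left_real by blast
  then show ?thesis by (simp add: mult_ac)
qed

theorem theorem2p2:
  fixes \<theta> \<gamma> :: real
  assumes "\<bar>\<theta>\<bar> < pi / 2" and "\<gamma> > 0"
  shows "(\<forall>f \<in> class_C \<theta> \<gamma>.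
            schwarzian_norm f \<le> ereal (2 * \<gamma> * cos \<theta> * sqrt (4 + (\<gamma>\<^sup>2 + 4 * \<gamma>) * (cos \<theta>)\<^sup>2))) \<and>
         (\<forall>M::real. (\<forall>f \<in> class_C \<theta> \<gamma>. schwarzian_norm f \<le> ereal M) \<longrightarrow>
            2 * \<gamma> * cos \<theta> * sqrt (4 + (\<gamma>\<^sup>2 + 4 * \<gamma>) * (cos \<theta>)\<^sup>2) \<le> M)"
proof -
  define A where "A = of_real (\<gamma> * cos \<theta>) / exp (\<i> * of_real \<theta>)"
  have c: "0 < cos \<theta>" using assms(1) by (intro cos_gt_zero_pi) auto
  then have k: "0 < \<gamma> * cos \<theta>" "0 \<le> cos \<theta>" using assms(2) by auto
  \<comment> \<open>With |A| = \<gamma> cos \<theta>, this identifies the asserted constant with 4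
    |A| |1 + A/2|, the form in which both halves are proved.\<close>
  have "sqrt (4 + (\<gamma>\<^sup>2 + 4 * \<gamma>) * (cos \<theta>)\<^sup>2) = 2 * cmod (1 + A/2)"
  proof (rule real_sqrt_unique)
    show "(2 * cmod (1 + A/2))\<^sup>2 = 4 + (\<gamma>\<^sup>2 + 4 * \<gamma>) * (cos \<theta>)\<^sup>2"
      unfolding power_mult_distrib A_def norm_one_plus_half_rotated
      by (simp add: power2_eq_square algebra_simps)
  qed simp
  moreover have "cmod A = \<gamma> * cos \<theta>"
    using c assms(2) by (simp add: A_def norm_divide norm_mult)
  ultimately have eq: "2 * \<gamma> * cos \<theta> * sqrt (4 + (\<gamma>\<^sup>2 + 4 * \<gamma>) * (cos \<theta>)\<^sup>2)
      = 4 * cmod A * cmod (1 + A/2)"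
    by simp
  \<comment> \<open>For sharpness, a bound \<open>M\<close> valid on the whole class is applied to
    \<open>extremal A\<close>.\<close>
  show ?thesis
    unfolding eq A_def
    using class_C_schwarzian_norm_le[OF k] extremal_in_class_C[OF k] schwarzian_norm_extremal_ge
    by blast
qed

end
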